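(* Let $N\ge 2$, $p\ge 2$, $0<r_0<R_0\le\infty$, $\Omega=B]r_0,R_0[$, and let $V\in C(\Omega)$ satisfy either $V>0$ in $\Omega$ or $V\equiv 0$ in $\Omega$. Assume that condition $( * )$ holds and that there exists a positive radial strictly monotone decreasing $C^2$-supersolution of $-\Delta_p w-V|w|^{p-2}w=0$ in $\Omega$. Let $u$ be a positive radial strictly monotone decreasing $C^2$-subsolution of this equation. Then at least one of the following alternatives occurs: (i) for every positive (not necessarily radial or decreasing) $C^2$-supersolution $w$ of the equation, there exists $C>0$ with $u(x)\le C\,w(x)$ for all $x\in B[r_0,R_0[$; (ii) for every positive radial strictly monotone decreasing $C^2$-supersolution $v$ of the equation, $u$ is not smaller than $v$, i.e. $$\limsup_{r\to R_0}\frac{u(r)}{v(r)}>0.$$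
   Context: $\Delta_p w=\nabla\cdot(|\nabla w|^{p-2}\nabla w)$. For $0<r_0<R_0\le\infty$, $B]r_0,R_0[=\{x\in\mathbb{R}^N: r_0<|x|<R_0\}$ and $B[r_0,R_0[=\{x\in\mathbb{R}^N: r_0\le|x|<R_0\}$. A $C^2$-subsolution (resp. supersolution) of $-\Delta_p w-V|w|^{p-2}w=0$ in $\Omega=B]r_0,R_0[$ is a function $w\in C^2(B[r_0,R_0[)$ (regular up to the sphere $|x|=r_0$, not necessarily up to $|x|=R_0$) satisfying $-\Delta_p w-V|w|^{p-2}w\le 0$ (resp. $\ge 0$) pointwise in $\Omega$. A radial function $w(x)=\phi(|x|)$ is identified with $\phi$, and $w'(r)=\phi'(r)$; it is strictly monotone decreasing if $w'(r)<0$ for all $r\in[r_0,R_0[$. Condition $( * )$: there exists $\varphi\in C^2(\Omega)$ with $\varphi>0$, $-\Delta_p\varphi-V\varphi^{p-1}\ge 0$ in $\Omega$ and $-\Delta_p\varphi-V\varphi^{p-1}\not\equiv 0$ in $\Omega$. *)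

theory Defs
  imports "HOL-Analysis.Analysis"
begin

definition grad :: "('a::euclidean_space \<Rightarrow> real) \<Rightarrow> 'a \<Rightarrow> 'a" where
  "grad w x = (\<Sum>i\<in>Basis. frechet_derivative w (at x) i *\<^sub>R i)"

definition divergence :: "('a::euclidean_space \<Rightarrow> 'a) \<Rightarrow> 'a \<Rightarrow> real" where
  "divergence F x = (\<Sum>i\<in>Basis. frechet_derivative F (at x) i \<bullet> i)"

definition p_laplacian :: "real \<Rightarrow> ('a::euclidean_space \<Rightarrow> real) \<Rightarrow> 'a \<Rightarrow> real" where
  "p_laplacian p w x = divergence (\<lambda>y. (norm (grad w y) powr (p - 2)) *\<^sub>R grad w y) x"

definition C2_open :: "'a::euclidean_space set \<Rightarrow> ('a \<Rightarrow> real) \<Rightarrow> bool" where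
  "C2_open U w \<longleftrightarrow> open U \<and>
     (\<forall>x\<in>U. w differentiable (at x)) \<and>
     (\<forall>x\<in>U. grad w differentiable (at x)) \<and>
     (\<forall>i\<in>Basis. \<forall>j\<in>Basis.
        continuous_on U (\<lambda>x. frechet_derivative (grad w) (at x) i \<bullet> j))"

definition C2_on :: "'a::euclidean_space set \<Rightarrow> ('a \<Rightarrow> real) \<Rightarrow> bool" where
  "C2_on S w \<longleftrightarrow> (\<exists>U. S \<subseteq> U \<and> C2_open U w)"

definition annulus_open :: "real \<Rightarrow> ereal \<Rightarrow> 'a::euclidean_space set" where
  "annulus_open r0 R0 = {x. r0 < norm x \<and> ereal (norm x) < R0}"

definition annulus_closed :: "real \<Rightarrow> ereal \<Rightarrow> 'a::euclidean_space set" where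
  "annulus_closed r0 R0 = {x. r0 \<le> norm x \<and> ereal (norm x) < R0}"

definition plap_op :: "real \<Rightarrow> ('a::euclidean_space \<Rightarrow> real) \<Rightarrow> ('a \<Rightarrow> real) \<Rightarrow> 'a \<Rightarrow> real" where
  "plap_op p V w x = - p_laplacian p w x - V x * (\<bar>w x\<bar> powr (p - 2)) * w x"

definition C2_subsolution :: "real \<Rightarrow> ('a::euclidean_space \<Rightarrow> real) \<Rightarrow> real \<Rightarrow> ereal \<Rightarrow> ('a \<Rightarrow> real) \<Rightarrow> bool" where
  "C2_subsolution p V r0 R0 w \<longleftrightarrow> C2_on (annulus_closed r0 R0) w \<and>
     (\<forall>x\<in>annulus_open r0 R0. plap_op p V w x \<le> 0)"

definition C2_supersolution :: "real \<Rightarrow> ('a::euclidean_space \<Rightarrow> real) \<Rightarrow> real \<Rightarrow> ereal \<Rightarrow> ('a \<Rightarrow> real) \<Rightarrow> bool" where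
  "C2_supersolution p V r0 R0 w \<longleftrightarrow> C2_on (annulus_closed r0 R0) w \<and>
     (\<forall>x\<in>annulus_open r0 R0. plap_op p V w x \<ge> 0)"

definition unit_dir :: "'a::euclidean_space" where
  "unit_dir = (SOME b. b \<in> Basis)"

definition profile :: "('a::euclidean_space \<Rightarrow> real) \<Rightarrow> real \<Rightarrow> real" where
  "profile w r = w (r *\<^sub>R unit_dir)"

definition radial_on :: "'a::euclidean_space set \<Rightarrow> ('a \<Rightarrow> real) \<Rightarrow> bool" where
  "radial_on S w \<longleftrightarrow> (\<forall>x\<in>S. \<forall>y\<in>S. norm x = norm y \<longrightarrow> w x = w y)"

definition strictly_decreasing_radial :: "real \<Rightarrow> ereal \<Rightarrow> ('a::euclidean_space \<Rightarrow> real) \<Rightarrow> bool" where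
  "strictly_decreasing_radial r0 R0 w \<longleftrightarrow>
     (\<forall>r. r0 \<le> r \<and> ereal r < R0 \<longrightarrow> profile w differentiable (at r) \<and> deriv (profile w) r < 0)"

definition pos_rad_dec_C2_sub :: "real \<Rightarrow> ('a::euclidean_space \<Rightarrow> real) \<Rightarrow> real \<Rightarrow> ereal \<Rightarrow> ('a \<Rightarrow> real) \<Rightarrow> bool" where
  "pos_rad_dec_C2_sub p V r0 R0 w \<longleftrightarrow> C2_subsolution p V r0 R0 w \<and>
     (\<forall>x\<in>annulus_closed r0 R0. w x > 0) \<and> radial_on (annulus_closed r0 R0) w \<and>
     strictly_decreasing_radial r0 R0 w"

definition pos_rad_dec_C2_super :: "real \<Rightarrow> ('a::euclidean_space \<Rightarrow> real) \<Rightarrow> real \<Rightarrow> ereal \<Rightarrow> ('a \<Rightarrow> real) \<Rightarrow> bool" where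
  "pos_rad_dec_C2_super p V r0 R0 w \<longleftrightarrow> C2_supersolution p V r0 R0 w \<and>
     (\<forall>x\<in>annulus_closed r0 R0. w x > 0) \<and> radial_on (annulus_closed r0 R0) w \<and>
     strictly_decreasing_radial r0 R0 w"

definition condition_star :: "real \<Rightarrow> ('a::euclidean_space \<Rightarrow> real) \<Rightarrow> real \<Rightarrow> ereal \<Rightarrow> bool" where
  "condition_star p V r0 R0 \<longleftrightarrow> (\<exists>\<phi>. C2_open (annulus_open r0 R0) \<phi> \<and>
     (\<forall>x\<in>annulus_open r0 R0. \<phi> x > 0) \<and>
     (\<forall>x\<in>annulus_open r0 R0. - p_laplacian p \<phi> x - V x * \<phi> x powr (p - 1) \<ge> 0) \<and>
     (\<exists>x\<in>annulus_open r0 R0. - p_laplacian p \<phi> x - V x * \<phi> x powr (p - 1) \<noteq> 0))"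

definition to_R0 :: "ereal \<Rightarrow> real filter" where
  "to_R0 R0 = (if R0 = \<infinity> then at_top else at_left (real_of_ereal R0))"

end

theory Submission
  imports Defs
begin

text \<open>
  Suppose the second alternative fails for \<open>v\<close>, so that \<open>u / v \<rightarrow> 0\<close>. A Riccati comparison of the
  logarithmic slopes of the profiles shows that \<open>u / v\<close> is nonincreasing, so \<open>u - \<epsilon> v\<close> is strictly
  decreasing in the radius wherever it is positive. For \<open>p \<ge> 2\<close> the perspective \<open>s\<^sup>p\<^sup>-\<^sup>1 t\<^sup>2\<^sup>-\<^sup>p\<close> is convex and
  1-homogeneous, hence subadditive, and this makes \<open>u - \<epsilon> v\<close> a subsolution there. Since its gradient
  does not vanish, a perturbation makes it a strict subsolution, and the quotient of the perturbation
  by an arbitrary positive supersolution \<open>w\<close> has no interior maximum: at such a point the gradients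
  agree up to a factor and the Hessians are ordered. So \<open>u - \<epsilon> v \<le> C w\<close>, where \<open>C\<close> depends only on the
  sphere \<open>|x| = r\<^sub>0\<close>; then \<open>\<epsilon> \<rightarrow> 0\<close>.
\<close>

section \<open>The p-Laplacian at points with nonzero gradient\<close>

lemma has_derivative_grad:
  fixes w :: "'a::euclidean_space \<Rightarrow> real"
  assumes "w differentiable (at x)"
  shows "(w has_derivative (\<lambda>e. grad w x \<bullet> e)) (at x)"
proof -
  define L where "L = frechet_derivative w (at x)"
  have L: "(w has_derivative L) (at x)"
    using assms frechet_derivative_works L_def by blast
  then interpret L: bounded_linear L by (rule has_derivative_bounded_linear)
  have "L e = grad w x \<bullet> e" for e
  proof -
    have "L e = L (\<Sum>b\<in>Basis. (e \<bullet> b) *\<^sub>R b)" by (simp add: euclidean_representation)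
    also have "\<dots> = (\<Sum>b\<in>Basis. (e \<bullet> b) * L b)" by (simp add: L.sum L.scaleR)
    also have "\<dots> = grad w x \<bullet> e"
      by (simp add: grad_def L_def inner_sum_left inner_commute[of e])
        (simp add: inner_commute mult.commute)
    finally show ?thesis .
  qed
  then have "L = (\<lambda>e. grad w x \<bullet> e)" by auto
  with L show ?thesis by simp
qed

lemma grad_eqI:
  fixes w :: "'a::euclidean_space \<Rightarrow> real"
  assumes "(w has_derivative (\<lambda>e. G \<bullet> e)) (at x)"
  shows "grad w x = G"
proof -
  have "frechet_derivative w (at x) = (\<lambda>e. G \<bullet> e)"
    using frechet_derivative_at[OF assms] by simp
  then show ?thesis by (simp add: grad_def euclidean_representation)
qed

text \<open>The product rule gives the nondivergence form, with \<open>D\<close> playing the role of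
  the Hessian. Since the norm is smooth away from zero, the nonvanishing gradient makes this work
  for every exponent. For \<open>p \<ge> 2\<close> the bracket is monotone in the quadratic form of
  \<open>D\<close>, which is what comparison at a touching point relies on.\<close>

lemma p_laplacian_eq:
  fixes w :: "'a::euclidean_space \<Rightarrow> real"
  assumes D: "(grad w has_derivative D) (at x)" and nz: "grad w x \<noteq> 0"
  shows "p_laplacian p w x = norm (grad w x) powr (p - 2) *
    ((\<Sum>b\<in>Basis. D b \<bullet> b) + (p - 2) * (D (grad w x) \<bullet> grad w x) / (norm (grad w x))\<^sup>2)"
proof -
  define G where "G = grad w x"
  define N where "N = norm G"
  interpret D: bounded_linear D using D by (rule has_derivative_bounded_linear)
  have N: "N > 0" using nz by (simp add: N_def G_def)
  have dn: "((\<lambda>y. norm (grad w y)) has_derivative (\<lambda>e. (D e \<bullet> G) / N)) (at x)"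
    using has_derivative_compose[OF D has_derivative_norm[of "grad w x"]] nz
    by (simp add: G_def N_def sgn_div_norm inner_commute divide_inverse mult.commute)
  have dp: "((\<lambda>y. norm (grad w y) powr (p - 2)) has_derivative
      (\<lambda>e. (p - 2) * N powr (p - 3) * ((D e \<bullet> G) / N))) (at x)"
    using has_derivative_powr[OF dn has_derivative_const, of "p - 2"] N
    by (simp add: N_def G_def powr_diff field_simps power2_eq_square power3_eq_cube)
  have dF: "((\<lambda>y. norm (grad w y) powr (p - 2) *\<^sub>R grad w y) has_derivative
      (\<lambda>e. N powr (p - 2) *\<^sub>R D e + ((p - 2) * N powr (p - 3) * ((D e \<bullet> G) / N)) *\<^sub>R G)) (at x)"
    using has_derivative_scaleR[OF dp D] by (simp add: G_def N_def)
  have Np: "N powr (p - 3) / N = N powr (p - 2) / N\<^sup>2"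
    using N by (simp add: powr_diff power2_eq_square power3_eq_cube)
  have "p_laplacian p w x = (\<Sum>b\<in>Basis. (N powr (p - 2) *\<^sub>R D b +
        ((p - 2) * N powr (p - 3) * ((D b \<bullet> G) / N)) *\<^sub>R G) \<bullet> b)"
    unfolding p_laplacian_def divergence_def
    using frechet_derivative_at[OF dF, symmetric] by simp
  also have "\<dots> = N powr (p - 2) * (\<Sum>b\<in>Basis. D b \<bullet> b)
      + (p - 2) * (N powr (p - 3) / N) * (\<Sum>b\<in>Basis. (D b \<bullet> G) * (G \<bullet> b))"
    by (simp add: inner_add_left sum.distrib sum_distrib_left sum_distrib_right mult_ac divide_inverse)
  also have "(\<Sum>b\<in>Basis. (D b \<bullet> G) * (G \<bullet> b)) = D (\<Sum>b\<in>Basis. (G \<bullet> b) *\<^sub>R b) \<bullet> G"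
    by (simp add: D.sum D.scaleR inner_sum_left mult_ac)
  also have "\<dots> = D G \<bullet> G" by (simp add: euclidean_representation)
  finally show ?thesis unfolding Np by (simp add: G_def N_def algebra_simps)
qed

section \<open>Derivatives and the p-Laplacian of radial functions\<close>

text \<open>The gradient of a radial function with profile derivative \<open>f\<close> is
  \<open>f\<close> times the unit radial field. Its derivative acts as \<open>f / norm x\<close> on
  tangential directions and as \<open>f'\<close> on the radial one; the formula writes this as a
  multiple of the identity plus a rank-one correction.\<close>

lemma has_derivative_radial_field:
  fixes x :: "'a::euclidean_space"
  assumes f: "(f has_real_derivative f') (at (norm x))" and x: "x \<noteq> 0"
  shows "((\<lambda>y. (f (norm y) / norm y) *\<^sub>R y) has_derivative
    (\<lambda>e. (f (norm x) / norm x) *\<^sub>R e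
       + ((f' - f (norm x) / norm x) * (x \<bullet> e) / (norm x)\<^sup>2) *\<^sub>R x)) (at x)"
proof -
  have q: "((\<lambda>r. f r / r) has_real_derivative (f' * norm x - f (norm x)) / (norm x * norm x)) (at (norm x))"
    using x by (auto intro!: derivative_eq_intros f)
  have "((\<lambda>y. f (norm y) / norm y) has_derivative
      (\<lambda>e. (f' * norm x - f (norm x)) / (norm x * norm x) * ((x \<bullet> e) / norm x))) (at x)"
    using has_derivative_compose[OF has_derivative_norm[OF x] q[unfolded has_field_derivative_def]]
    by (simp add: sgn_div_norm inner_commute divide_inverse mult.commute)
  from has_derivative_scaleR[OF this has_derivative_ident]
  show ?thesis
    by (rule has_derivative_eq_rhs) (use x in \<open>auto simp: field_simps power2_eq_square\<close>)
qed

lemma has_derivative_radial: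
  fixes x :: "'a::euclidean_space"
  assumes f: "(f has_real_derivative f') (at (norm x))" and x: "x \<noteq> 0"
  shows "((\<lambda>y. f (norm y)) has_derivative (\<lambda>e. ((f' / norm x) *\<^sub>R x) \<bullet> e)) (at x)"
  using has_derivative_compose[OF has_derivative_norm[OF x] f[unfolded has_field_derivative_def]]
  by (simp add: sgn_div_norm inner_commute divide_inverse mult_ac)

text \<open>The profile \<open>f\<close> and its derivative \<open>g\<close> are parameters on an
  arbitrary open set, so the results serve both the profiles of the given solutions and the profile
  of a perturbed difference.\<close>

context
  fixes w :: "'a::euclidean_space \<Rightarrow> real" and f g :: "real \<Rightarrow> real" and S
  assumes S: "open S" "0 \<notin> S"
    and w: "\<And>y. y \<in> S \<Longrightarrow> w y = f (norm y)"
    and f: "\<And>y. y \<in> S \<Longrightarrow> (f has_real_derivative g (norm y)) (at (norm y))"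
begin

lemma radial_has_derivative:
  assumes y: "y \<in> S"
  shows "(w has_derivative (\<lambda>e. ((g (norm y) / norm y) *\<^sub>R y) \<bullet> e)) (at y)"
proof -
  have "((\<lambda>y. f (norm y)) has_derivative (\<lambda>e. ((g (norm y) / norm y) *\<^sub>R y) \<bullet> e)) (at y)"
    using f[OF y] y S by (intro has_derivative_radial) auto
  then show ?thesis
    by (rule has_derivative_transform_within_open[OF _ S(1) y]) (simp add: w)
qed

lemmas grad_radial = radial_has_derivative[THEN grad_eqI]

lemma grad_radial_has_derivative:
  assumes x: "x \<in> S" and g: "(g has_real_derivative g') (at (norm x))"
  shows "(grad w has_derivative (\<lambda>e. (g (norm x) / norm x) *\<^sub>R e
       + ((g' - g (norm x) / norm x) * (x \<bullet> e) / (norm x)\<^sup>2) *\<^sub>R x)) (at x)"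
  using x S by (intro has_derivative_transform_within_open[OF has_derivative_radial_field[OF g] S(1) x])
    (auto simp: grad_radial)

text \<open>The Hessian has eigenvalue \<open>g'\<close> in the radial direction and
  \<open>g / r\<close> in the remaining \<open>DIM('a) - 1\<close> directions. The gradient is
  radial, so the second term of the nondivergence form contributes another
  \<open>(p - 2) * g'\<close>.\<close>

lemma p_laplacian_radial:
  assumes xS: "x \<in> S" and g: "(g has_real_derivative g') (at (norm x))"
    and nz: "g (norm x) \<noteq> 0"
  shows "p_laplacian p w x = \<bar>g (norm x)\<bar> powr (p - 2) *
    ((p - 1) * g' + (real DIM('a) - 1) / norm x * g (norm x))"
proof -
  define D where "D = (\<lambda>e. (g (norm x) / norm x) *\<^sub>R e
       + ((g' - g (norm x) / norm x) * (x \<bullet> e) / (norm x)\<^sup>2) *\<^sub>R x)"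
  have D: "(grad w has_derivative D) (at x)"
    unfolding D_def using xS g by (rule grad_radial_has_derivative)
  note gx = grad_radial[OF xS]
  have x: "x \<noteq> 0" using xS S by auto
  have nG: "norm (grad w x) = \<bar>g (norm x)\<bar>" using x by (simp add: gx)
  have sq: "(\<Sum>b\<in>Basis. (x \<bullet> b) * (x \<bullet> b)) = (norm x)\<^sup>2"
    by (metis euclidean_inner power2_norm_eq_inner)
  have tr: "(\<Sum>b\<in>Basis. D b \<bullet> b) = g' + (real DIM('a) - 1) * g (norm x) / norm x"
  proof -
    define k where "k = (g' - g (norm x) / norm x) / (norm x)\<^sup>2"
    have "D b \<bullet> b = g (norm x) / norm x + k * ((x \<bullet> b) * (x \<bullet> b))" if "b \<in> Basis" for b
      using that by (simp add: D_def k_def inner_add_left)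
    then have "(\<Sum>b\<in>Basis. D b \<bullet> b) = real DIM('a) * (g (norm x) / norm x) + k * (norm x)\<^sup>2"
      by (simp add: sum.distrib sq flip: sum_distrib_left)
    moreover have "k * (norm x)\<^sup>2 = g' - g (norm x) / norm x"
      using x by (simp add: k_def)
    ultimately show ?thesis by (simp add: diff_divide_distrib left_diff_distrib)
  qed
  have "D (grad w x) \<bullet> grad w x = g' * (g (norm x))\<^sup>2"
    using x by (simp add: D_def gx inner_add_left dot_square_norm power2_eq_square field_simps)
  then have quad: "(p - 2) * (D (grad w x) \<bullet> grad w x) / (norm (grad w x))\<^sup>2 = (p - 2) * g'"
    using nz by (simp add: nG)
  have "grad w x \<noteq> 0" using nz x by (simp add: gx)
  from p_laplacian_eq[OF D this, of p, unfolded quad tr]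
  show ?thesis by (simp add: nG algebra_simps)
qed

end

section \<open>Comparison at a touching point\<close>

text \<open>If the second derivative in direction \<open>e\<close> were negative, the slope along
  that line, being zero at \<open>x\<close>, would be negative just after it. The mean value theorem
  would then produce a value below the minimum. Differentiability of the gradient at the single
  point \<open>x\<close> suffices for this argument.\<close>

lemma second_order_min:
  fixes g :: "'a::euclidean_space \<Rightarrow> real"
  assumes S: "open S" "x \<in> S" and min: "\<And>y. y \<in> S \<Longrightarrow> g x \<le> g y"
    and g: "\<And>y. y \<in> S \<Longrightarrow> (g has_derivative (\<lambda>e. \<Gamma> y \<bullet> e)) (at y)"
    and D: "(\<Gamma> has_derivative D) (at x)"
  shows "\<Gamma> x = 0" and "0 \<le> D e \<bullet> e"
proof -
  have "(\<lambda>e. \<Gamma> x \<bullet> e) = (\<lambda>e. 0)"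
    using differential_zero_maxmin[OF S(2,1) g[OF S(2)]] min by blast
  then show 0: "\<Gamma> x = 0" by (metis inner_eq_zero_iff)
  show "0 \<le> D e \<bullet> e"
  proof (rule ccontr)
    assume "\<not> 0 \<le> D e \<bullet> e"
    then have neg: "D e \<bullet> e < 0" by simp
    define q where "q t = \<Gamma> (x + t *\<^sub>R e) \<bullet> e" for t
    interpret D: bounded_linear D using D by (rule has_derivative_bounded_linear)
    have line: "((\<lambda>t. x + t *\<^sub>R e) has_derivative (\<lambda>t. t *\<^sub>R e)) (at s)" for s
      by (auto intro!: derivative_eq_intros)
    have "((\<lambda>t. \<Gamma> (x + t *\<^sub>R e)) has_derivative (\<lambda>t. D (t *\<^sub>R e))) (at 0)"
      using D by (intro has_derivative_compose[OF line]) simp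
    from has_derivative_inner_left[OF this, of e]
    have "(q has_real_derivative D e \<bullet> e) (at 0)"
      unfolding q_def has_field_derivative_def
      by (rule has_derivative_eq_rhs) (auto simp: D.scaleR)
    from DERIV_neg_dec_right[OF this neg]
    obtain d where d: "d > 0" "\<And>h. 0 < h \<Longrightarrow> h < d \<Longrightarrow> q h < 0"
      using 0 by (auto simp: q_def)
    obtain r where r: "r > 0" "ball x r \<subseteq> S" using S openE by blast
    \<comment> \<open>The first bound keeps the slope \<open>q\<close> negative up to
      \<open>h\<close>; the second keeps the whole segment inside the ball of radius
      \<open>r\<close> contained in \<open>S\<close>.\<close>
    define h where "h = min (d / 2) (r / (2 * (norm e + 1)))"
    have h: "0 < h" "h < d" using d(1) r(1) norm_ge_zero[of e]
      by (auto simp: h_def min_less_iff_disj intro!: divide_pos_pos add_nonneg_pos)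
    have inS: "x + t *\<^sub>R e \<in> S" if "0 \<le> t" "t \<le> h" for t
    proof -
      have "t * norm e \<le> r / (2 * (norm e + 1)) * (norm e + 1)"
        using that r(1) by (intro mult_mono) (auto simp: h_def)
      also have "\<dots> = r / 2" by (simp add: field_simps add_nonneg_eq_0_iff)
      finally have "t * norm e \<le> r / 2" .
      then show ?thesis using that r by (auto simp: dist_norm subset_iff)
    qed
    have "((\<lambda>t. g (x + t *\<^sub>R e)) has_real_derivative q t) (at t)" if "0 \<le> t" "t \<le> h" for t
      unfolding has_field_derivative_def q_def
      by (rule has_derivative_eq_rhs[OF has_derivative_compose[OF line g[OF inS[OF that]]]]) auto
    from MVT2[OF h(1) this] obtain z where "0 < z" "z < h"
      "g (x + h *\<^sub>R e) - g (x + 0 *\<^sub>R e) = (h - 0) * q z" by blast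
    moreover have "q z < 0" using d calculation h by auto
    moreover have "g x \<le> g (x + h *\<^sub>R e)" using min inS h by auto
    ultimately show False using h mult_pos_neg[of h "q z"] by auto
  qed
qed

text \<open>At the touching point \<open>k * w - h\<close> has a minimum, so the gradients agree up
  to the factor \<open>k\<close> and the Hessians are ordered. The nondivergence form preserves this
  order because \<open>p - 2 \<ge> 0\<close>. The gradient contributes the power
  \<open>k powr (p - 2)\<close> and the Hessian one more factor \<open>k\<close>.\<close>

lemma p_laplacian_touching:
  fixes h w :: "'a::euclidean_space \<Rightarrow> real"
  assumes p: "p \<ge> 2" and k: "k > 0" and S: "open S" "x \<in> S"
    and le: "\<And>y. y \<in> S \<Longrightarrow> h y \<le> k * w y" and eq: "h x = k * w x"
    and h: "\<And>y. y \<in> S \<Longrightarrow> h differentiable (at y)" "grad h differentiable (at x)" "grad h x \<noteq> 0"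
    and w: "\<And>y. y \<in> S \<Longrightarrow> w differentiable (at y)" "grad w differentiable (at x)"
  shows "p_laplacian p h x \<le> k powr (p - 1) * p_laplacian p w x"
proof -
  obtain A where A: "(grad h has_derivative A) (at x)" using h(2) differentiable_def by blast
  obtain B where B: "(grad w has_derivative B) (at x)" using w(2) differentiable_def by blast
  interpret A: bounded_linear A using A by (rule has_derivative_bounded_linear)
  define G where "G = grad w x"
  define \<Gamma> where "\<Gamma> y = k *\<^sub>R grad w y - grad h y" for y
  have g: "((\<lambda>y. k * w y - h y) has_derivative (\<lambda>e. \<Gamma> y \<bullet> e)) (at y)" if "y \<in> S" for y
    unfolding \<Gamma>_def
    by (auto intro!: derivative_eq_intros has_derivative_grad h w that simp: inner_diff_left)
  have D: "(\<Gamma> has_derivative (\<lambda>e. k *\<^sub>R B e - A e)) (at x)"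
    unfolding \<Gamma>_def by (auto intro!: derivative_eq_intros A B)
  have min: "k * w x - h x \<le> k * w y - h y" if "y \<in> S" for y using le[OF that] eq by simp
  note so = second_order_min[OF S min g D]
  have G: "grad h x = k *\<^sub>R G" "G \<noteq> 0" using so(1) h(3) by (auto simp: \<Gamma>_def G_def)
  have quad: "A e \<bullet> e \<le> k * (B e \<bullet> e)" for e
    using so(2)[of e] by (simp add: inner_diff_left)
  have "p_laplacian p h x = norm (k *\<^sub>R G) powr (p - 2) *
    ((\<Sum>b\<in>Basis. A b \<bullet> b) + (p - 2) * (A (k *\<^sub>R G) \<bullet> (k *\<^sub>R G)) / (norm (k *\<^sub>R G))\<^sup>2)"
    using p_laplacian_eq[OF A h(3), of p] by (simp add: G)
  also have "\<dots> = (k * norm G) powr (p - 2) *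
    ((\<Sum>b\<in>Basis. A b \<bullet> b) + (p - 2) * (A G \<bullet> G) / (norm G)\<^sup>2)"
    using k by (simp add: A.scaleR power_mult_distrib power2_eq_square)
  also have "\<dots> \<le> (k * norm G) powr (p - 2) *
    ((\<Sum>b\<in>Basis. k * (B b \<bullet> b)) + (p - 2) * (k * (B G \<bullet> G)) / (norm G)\<^sup>2)"
    using p by (intro mult_left_mono add_mono sum_mono divide_right_mono quad) auto
  also have "\<dots> = k powr (p - 1) * (norm G powr (p - 2) *
    ((\<Sum>b\<in>Basis. B b \<bullet> b) + (p - 2) * (B G \<bullet> G) / (norm G)\<^sup>2))"
  proof -
    have "k powr (p - 1) = k * k powr (p - 2)"
      using k powr_add[of k 1 "p - 2"] by simp
    then show ?thesis using k by (simp add: powr_mult sum_distrib_left[symmetric] algebra_simps)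
  qed
  also have "\<dots> = k powr (p - 1) * p_laplacian p w x"
    using p_laplacian_eq[OF B, of p] G(2) by (simp add: G_def)
  finally show ?thesis .
qed

text \<open>Each term equals \<open>t * (s / t) powr (p - 1)\<close>, the perspective of a convex
  power. Jensen's inequality at the points \<open>s1 / t1\<close> and \<open>s2 / t2\<close> with
  weights \<open>t1 / T\<close> and \<open>t2 / T\<close> gives the claim after multiplication by
  \<open>T\<close>.\<close>

lemma perspective_powr_subadditive:
  fixes s1 s2 t1 t2 p :: real
  assumes p: "p \<ge> 2" and pos: "s1 > 0" "s2 > 0" "t1 > 0" "t2 > 0"
  shows "(s1 + s2) powr (p - 1) * (t1 + t2) powr (2 - p)
    \<le> s1 powr (p - 1) * t1 powr (2 - p) + s2 powr (p - 1) * t2 powr (2 - p)"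
proof -
  have *: "s powr (p - 1) * t powr (2 - p) = t * (s / t) powr (p - 1)" if "s > 0" "t > 0" for s t :: real
  proof -
    have "(s / t) powr (p - 1) = s powr (p - 1) * t powr (1 - p)"
      using that powr_minus_divide[of t "p - 1"] by (simp add: powr_divide)
    moreover have "t powr (2 - p) = t * t powr (1 - p)"
      using that powr_add[of t 1 "1 - p"] by simp
    ultimately show ?thesis by simp
  qed
  define T where "T = t1 + t2"
  have T: "T > 0" using pos by (simp add: T_def)
  have 1: "1 - t2 / T = t1 / T" using T by (simp add: T_def field_simps)
  have "((1 - t2 / T) *\<^sub>R (s1 / t1) + (t2 / T) *\<^sub>R (s2 / t2)) powr (p - 1)
    \<le> (1 - t2 / T) * (s1 / t1) powr (p - 1) + (t2 / T) * (s2 / t2) powr (p - 1)"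
    using p pos T by (intro convex_onD[OF powr_convex]) (auto simp: T_def)
  moreover have "(t1 / T) *\<^sub>R (s1 / t1) + (t2 / T) *\<^sub>R (s2 / t2) = (s1 + s2) / T"
    using pos by (simp add: add_divide_distrib)
  ultimately have "T * ((s1 + s2) / T) powr (p - 1)
    \<le> t1 * (s1 / t1) powr (p - 1) + t2 * (s2 / t2) powr (p - 1)"
    using T unfolding 1 by (simp add: field_simps)
  then show ?thesis using pos T by (simp add: * T_def)
qed

section \<open>Radial profiles\<close>

lemma unit_dir_Basis: "(unit_dir :: 'a::euclidean_space) \<in> Basis"
  unfolding unit_dir_def by (rule someI_ex) (use nonempty_Basis in blast)

lemma norm_unit_dir [simp]: "norm (unit_dir :: 'a::euclidean_space) = 1"
  by (rule norm_Basis[OF unit_dir_Basis])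

lemma open_ereal_interval: "open {r::real. r0 < r \<and> ereal r < R0}"
  by (intro open_Collect_conj open_Collect_less continuous_on_ereal continuous_on_const continuous_on_id)

lemma open_annulus_open: "open (annulus_open r0 R0 :: 'a::euclidean_space set)"
  unfolding annulus_open_def
  by (intro open_Collect_conj open_Collect_less continuous_on_ereal continuous_on_const
      continuous_on_norm_id)

text \<open>Only regularity, radial symmetry and monotonicity are assumed, so everything here
  applies to subsolutions and supersolutions alike.\<close>

context
  fixes u :: "'a::euclidean_space \<Rightarrow> real" and r0 :: real and R0 :: ereal
  assumes r0: "0 < r0"
    and C2: "C2_on (annulus_closed r0 R0) u"
    and rad: "radial_on (annulus_closed r0 R0) u"
    and dec: "strictly_decreasing_radial r0 R0 u"
begin

lemma radial_eq_profile:
  assumes "x \<in> annulus_closed r0 R0"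
  shows "u x = profile u (norm x)"
proof -
  have "norm x *\<^sub>R unit_dir \<in> (annulus_closed r0 R0 :: 'a set)"
    using assms by (simp add: annulus_closed_def)
  from rad[unfolded radial_on_def, rule_format, OF assms this] show ?thesis
    by (simp add: profile_def)
qed

lemma profile_has_derivative:
  assumes "r0 \<le> r" "ereal r < R0"
  shows "(profile u has_real_derivative deriv (profile u) r) (at r)"
  using dec assms unfolding strictly_decreasing_radial_def DERIV_deriv_iff_real_differentiable by blast

lemma deriv_profile_neg:
  assumes "r0 \<le> r" "ereal r < R0"
  shows "deriv (profile u) r < 0"
  using dec assms unfolding strictly_decreasing_radial_def by blast

text \<open>Along the ray through \<open>unit_dir\<close> the derivative of the profile is the
  component of the gradient in that direction. This identity is established on an open interval
  around \<open>r\<close>, so differentiability of the gradient passes to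
  \<open>deriv (profile u)\<close>.\<close>

lemma profile_has_second_derivative:
  assumes "r0 < r" "ereal r < R0"
  shows "(deriv (profile u) has_real_derivative deriv (deriv (profile u)) r) (at r)"
proof -
  let ?e = "unit_dir :: 'a"
  obtain U where U: "annulus_closed r0 R0 \<subseteq> U" "\<And>x. x \<in> U \<Longrightarrow> u differentiable (at x)"
    "\<And>x. x \<in> U \<Longrightarrow> grad u differentiable (at x)"
    using C2 unfolding C2_on_def C2_open_def by blast
  have line: "((\<lambda>t. t *\<^sub>R ?e) has_derivative (\<lambda>t. t *\<^sub>R ?e)) (at s)" for s
    by (auto intro!: derivative_eq_intros)
  have inU: "s *\<^sub>R ?e \<in> U" if "r0 < s" "ereal s < R0" for s
    using U(1) that r0 by (auto simp: annulus_closed_def subset_iff)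
  have d: "deriv (profile u) s = grad u (s *\<^sub>R ?e) \<bullet> ?e" if "r0 < s" "ereal s < R0" for s
  proof (rule DERIV_imp_deriv)
    show "(profile u has_real_derivative grad u (s *\<^sub>R ?e) \<bullet> ?e) (at s)"
      unfolding has_field_derivative_def profile_def[abs_def]
      by (rule has_derivative_eq_rhs[OF has_derivative_compose[OF line
            has_derivative_grad[OF U(2)[OF inU[OF that]]]]]) auto
  qed
  obtain D where D: "(grad u has_derivative D) (at (r *\<^sub>R ?e))"
    using U(3)[OF inU[OF assms]] differentiable_def by blast
  then interpret D: bounded_linear D by (rule has_derivative_bounded_linear)
  have "((\<lambda>t. grad u (t *\<^sub>R ?e) \<bullet> ?e) has_derivative (\<lambda>t. D (t *\<^sub>R ?e) \<bullet> ?e)) (at r)"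
    by (intro has_derivative_inner_left has_derivative_compose[OF line] D)
  then have "((\<lambda>t. grad u (t *\<^sub>R ?e) \<bullet> ?e) has_real_derivative D ?e \<bullet> ?e) (at r)"
    unfolding has_field_derivative_def by (rule has_derivative_eq_rhs) (auto simp: D.scaleR)
  then have "(deriv (profile u) has_real_derivative D ?e \<bullet> ?e) (at r)"
    by (rule has_field_derivative_transform_within_open[OF _ open_ereal_interval[of r0 R0]])
      (use assms in \<open>auto simp: d\<close>)
  then show ?thesis by (simp add: DERIV_imp_deriv)
qed

lemma p_laplacian_profile:
  assumes x: "x \<in> annulus_open r0 R0"
  shows "p_laplacian p u x = (- deriv (profile u) (norm x)) powr (p - 2) *
    ((p - 1) * deriv (deriv (profile u)) (norm x)
      + (real DIM('a) - 1) / norm x * deriv (profile u) (norm x))"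
proof -
  have neg: "deriv (profile u) (norm x) < 0"
    using x by (intro deriv_profile_neg) (auto simp: annulus_open_def)
  have "p_laplacian p u x = \<bar>deriv (profile u) (norm x)\<bar> powr (p - 2) *
    ((p - 1) * deriv (deriv (profile u)) (norm x)
      + (real DIM('a) - 1) / norm x * deriv (profile u) (norm x))"
  proof (rule p_laplacian_radial[where S = "annulus_open r0 R0" and f = "profile u"
        and g = "deriv (profile u)"])
    show "open (annulus_open r0 R0 :: 'a set)" by (rule open_annulus_open)
    show "(profile u has_real_derivative deriv (profile u) (norm y)) (at (norm y))"
      if "y \<in> annulus_open r0 R0" for y :: 'a
      using that by (intro profile_has_derivative) (auto simp: annulus_open_def)
    show "u y = profile u (norm y)" if "y \<in> annulus_open r0 R0" for y
      by (rule radial_eq_profile) (use that in \<open>simp add: annulus_open_def annulus_closed_def\<close>)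
    show "(deriv (profile u) has_real_derivative deriv (deriv (profile u)) (norm x)) (at (norm x))"
      using x by (intro profile_has_second_derivative) (auto simp: annulus_open_def)
    show "0 \<notin> (annulus_open r0 R0 :: 'a set)" using r0 by (simp add: annulus_open_def)
    show "x \<in> annulus_open r0 R0" by (rule x)
    show "deriv (profile u) (norm x) \<noteq> 0" using neg by linarith
  qed
  then show ?thesis unfolding abs_of_neg[OF neg] .
qed

text \<open>Dividing by the positive factor \<open>(- u')\<^sup>p\<^sup>-\<^sup>2\<close> puts the radial equation in a form whose right-hand
  side is the perspective of the convex function \<open>t\<^sup>p\<^sup>-\<^sup>1\<close>.\<close>

lemma plap_op_profile:
  assumes x: "x \<in> annulus_open r0 R0" and pos: "u x > 0"
  shows "plap_op p V u x = (- deriv (profile u) (norm x)) powr (p - 2) *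
    ((p - 1) * - deriv (deriv (profile u)) (norm x)
      + (real DIM('a) - 1) / norm x * - deriv (profile u) (norm x)
      - V x * (profile u (norm x) powr (p - 1) * (- deriv (profile u) (norm x)) powr (2 - p)))"
proof -
  have "deriv (profile u) (norm x) < 0"
    using x by (intro deriv_profile_neg) (auto simp: annulus_open_def)
  then have neg: "- deriv (profile u) (norm x) > 0" by simp
  have ux: "u x = profile u (norm x)"
    by (rule radial_eq_profile) (use x in \<open>simp add: annulus_open_def annulus_closed_def\<close>)
  have 1: "\<bar>u x\<bar> powr (p - 2) * u x = profile u (norm x) powr (p - 1)"
    using pos powr_add[of "u x" 1 "p - 2"] by (simp add: ux mult.commute)
  have 2: "(- deriv (profile u) (norm x)) powr (p - 2) * (- deriv (profile u) (norm x)) powr (2 - p) = 1"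
    using neg powr_add[of "- deriv (profile u) (norm x)" "p - 2" "2 - p"] by simp
  have "plap_op p V u x = - p_laplacian p u x - V x * (\<bar>u x\<bar> powr (p - 2) * u x)"
    by (simp add: plap_op_def)
  also have "\<dots> = - p_laplacian p u x - V x * (profile u (norm x) powr (p - 1)) *
      ((- deriv (profile u) (norm x)) powr (p - 2) * (- deriv (profile u) (norm x)) powr (2 - p))"
    unfolding 1 2 by simp
  finally have "plap_op p V u x = - p_laplacian p u x - V x * (profile u (norm x) powr (p - 1)) *
      ((- deriv (profile u) (norm x)) powr (p - 2) * (- deriv (profile u) (norm x)) powr (2 - p))" .
  moreover have "- (A * (c * d + e * g)) - v * q * (A * B) = A * (c * - d + e * - g - v * (q * B))"
    for A B c d e g v q :: real
    by (simp add: algebra_simps)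
  ultimately show ?thesis
    unfolding p_laplacian_profile[OF x] by (rule trans)
qed

end

section \<open>Riccati comparison of logarithmic slopes\<close>

text \<open>The logarithmic slope \<open>y = a / U\<close> satisfies
  \<open>y' = a' / U + y * y\<close>. With the weight \<open>t powr n\<close> the derivative
  separates into the radial operator \<open>(p - 1) * a' + n / t * a\<close>, where the differential
  inequality can be inserted, and a term increasing in \<open>y\<close>.\<close>

lemma riccati_weight_derivative:
  fixes a U :: "real \<Rightarrow> real"
  assumes t: "t > 0" and U: "(U has_real_derivative - a t) (at t)" "U t > 0"
    and a: "(a has_real_derivative a') (at t)" "a t > 0"
  shows "((\<lambda>t. t powr n * (a t / U t) powr (p - 1)) has_real_derivative
    t powr n * ((a t / U t) powr (p - 2) / U t * ((p - 1) * a' + n / t * a t)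
      + (p - 1) * (a t / U t) powr p)) (at t)"
proof -
  define y where "y = a t / U t"
  have y: "y > 0" using U a by (simp add: y_def)
  have pw: "y powr (p - 1) = y * y powr (p - 2)" "y powr p = y * y * y powr (p - 2)"
    "t powr (n - 1) = t powr n / t"
    using y t powr_add[of y 1 "p - 2"] powr_add[of y 2 "p - 2"] powr_diff[of t n 1]
    by (simp_all add: power2_eq_square)
  have dy: "((\<lambda>t. a t / U t) has_real_derivative a' / U t + y * y) (at t)"
    using U a by (auto intro!: derivative_eq_intros simp: y_def field_simps)
  have "((\<lambda>t. (a t / U t) powr (p - 1)) has_real_derivative
      (p - 1) * y powr (p - 2) * (a' / U t + y * y)) (at t)"
    using DERIV_chain2[OF has_real_derivative_powr[of "a t / U t" "p - 1"] dy] y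
    by (simp add: y_def)
  moreover have "((\<lambda>t. t powr n) has_real_derivative n * (t powr n / t)) (at t)"
    using has_real_derivative_powr[OF t, of n] by (simp add: pw)
  ultimately have "((\<lambda>t. t powr n * (a t / U t) powr (p - 1)) has_real_derivative
      t powr n * ((p - 1) * y powr (p - 2) * (a' / U t + y * y)) + n * (t powr n / t) * y powr (p - 1)) (at t)"
    unfolding y_def by (rule DERIV_cong[OF DERIV_mult[rotated]]) (simp add: mult_ac)
  also have "t powr n * ((p - 1) * y powr (p - 2) * (a' / U t + y * y)) + n * (t powr n / t) * y powr (p - 1)
    = t powr n * (y powr (p - 2) / U t * ((p - 1) * a' + n / t * (y * U t)) + (p - 1) * y powr p)"
  proof -
    have "P / U t * (c * a' + n / t * (y * U t)) = c * P * (a' / U t) + n / t * (y * P)" for P c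
      using U(2) by (simp add: add_divide_distrib distrib_left mult_ac)
    then show ?thesis using U(2) unfolding pw by (simp add: distrib_left mult_ac)
  qed
  finally show ?thesis using U by (simp add: y_def)
qed

lemma powr_less_iff:
  fixes x y q :: real
  assumes "x > 0" "y > 0" "q > 0"
  shows "x powr q < y powr q \<longleftrightarrow> x < y"
  using powr_less_mono2[of q x y] powr_mono2[of q y x] assms by linarith

text \<open>In \<open>(t\<^sup>n (b / W)\<^sup>p\<^sup>-\<^sup>1 - t\<^sup>n (a / U)\<^sup>p\<^sup>-\<^sup>1)'\<close> the potential \<open>k\<close> cancels, and what remains is nonnegative
  wherever the difference is positive; so the difference stays positive once it is.\<close>

lemma ratio_nondecreasing_after:
  fixes a b U W k :: "real \<Rightarrow> real"
  assumes p: "p \<ge> 2" and r: "0 < r" "r \<le> s"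
    and U: "\<And>t. t \<in> {r..s} \<Longrightarrow> (U has_real_derivative - a t) (at t)" "\<And>t. t \<in> {r..s} \<Longrightarrow> U t > 0"
    and a: "\<And>t. t \<in> {r..s} \<Longrightarrow> (a has_real_derivative a' t) (at t)" "\<And>t. t \<in> {r..s} \<Longrightarrow> a t > 0"
    and W: "\<And>t. t \<in> {r..s} \<Longrightarrow> (W has_real_derivative - b t) (at t)" "\<And>t. t \<in> {r..s} \<Longrightarrow> W t > 0"
    and b: "\<And>t. t \<in> {r..s} \<Longrightarrow> (b has_real_derivative b' t) (at t)" "\<And>t. t \<in> {r..s} \<Longrightarrow> b t > 0"
    and sub: "\<And>t. t \<in> {r..s} \<Longrightarrow>
      (p - 1) * a' t + n / t * a t \<le> k t * (U t powr (p - 1) * a t powr (2 - p))"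
    and super: "\<And>t. t \<in> {r..s} \<Longrightarrow>
      (p - 1) * b' t + n / t * b t \<ge> k t * (W t powr (p - 1) * b t powr (2 - p))"
    and start: "a r / U r < b r / W r"
  shows "U r / W r \<le> U s / W s"
proof -
  \<comment> \<open>The factor that multiplies the radial operator in the weighted derivative is
    exactly the reciprocal of the perspective term. The same bare potential \<open>k t\<close> is
    therefore left for both functions.\<close>
  have unit: "(x / y) powr (p - 2) / y * (c * (y powr (p - 1) * x powr (2 - p))) = c"
    if "x > 0" "y > 0" for x y c :: real
  proof -
    have "y powr (p - 1) = y * y powr (p - 2)" using that powr_add[of y 1 "p - 2"] by simp
    moreover have "x powr (2 - p) = inverse (x powr (p - 2))"
      using powr_minus[of x "p - 2"] by simp
    ultimately show ?thesis using that by (simp add: powr_divide field_simps)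
  qed
  define E where "E t = t powr n * (b t / W t) powr (p - 1) - t powr n * (a t / U t) powr (p - 1)" for t
  define E' where "E' t = t powr n * ((b t / W t) powr (p - 2) / W t * ((p - 1) * b' t + n / t * b t)
        + (p - 1) * (b t / W t) powr p)
      - t powr n * ((a t / U t) powr (p - 2) / U t * ((p - 1) * a' t + n / t * a t)
        + (p - 1) * (a t / U t) powr p)" for t
  have E: "(E has_real_derivative E' t) (at t)" if "t \<in> {r..s}" for t
    unfolding E_def E'_def using that r U a W b
    by (intro DERIV_diff riccati_weight_derivative) auto
  have Epos: "E t > 0 \<longleftrightarrow> a t / U t < b t / W t" if t: "t \<in> {r..s}" for t
  proof -
    have "E t > 0 \<longleftrightarrow> (a t / U t) powr (p - 1) < (b t / W t) powr (p - 1)"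
      using t r by (simp add: E_def)
    also have "\<dots> \<longleftrightarrow> a t / U t < b t / W t"
      using U(2)[OF t] a(2)[OF t] W(2)[OF t] b(2)[OF t] p by (intro powr_less_iff) auto
    finally show ?thesis .
  qed
  have E'pos: "E' t \<ge> 0" if t: "t \<in> {r..s}" and "E t > 0" for t
  proof -
    have lt: "a t / U t < b t / W t" using that Epos by blast
    have "(a t / U t) powr (p - 2) / U t * ((p - 1) * a' t + n / t * a t)
        \<le> (a t / U t) powr (p - 2) / U t * (k t * (U t powr (p - 1) * a t powr (2 - p)))"
      using U(2)[OF t] by (intro mult_left_mono sub t) auto
    also have "\<dots> = k t" using U(2)[OF t] a(2)[OF t] by (intro unit)
    also have "\<dots> = (b t / W t) powr (p - 2) / W t * (k t * (W t powr (p - 1) * b t powr (2 - p)))"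
      using W(2)[OF t] b(2)[OF t] by (intro unit[symmetric])
    also have "\<dots> \<le> (b t / W t) powr (p - 2) / W t * ((p - 1) * b' t + n / t * b t)"
      using W(2)[OF t] by (intro mult_left_mono super t) auto
    finally have 1: "(a t / U t) powr (p - 2) / U t * ((p - 1) * a' t + n / t * a t)
      \<le> (b t / W t) powr (p - 2) / W t * ((p - 1) * b' t + n / t * b t)" .
    have 2: "(p - 1) * (a t / U t) powr p \<le> (p - 1) * (b t / W t) powr p"
      using lt p U(2)[OF t] a(2)[OF t] by (intro mult_left_mono powr_mono2) auto
    show ?thesis unfolding E'_def using mult_left_mono[OF add_mono[OF 1 2], of "t powr n"] by simp
  qed
  have contE: "continuous_on {r..s} E"
    using E by (intro DERIV_continuous_on) (blast intro: has_field_derivative_at_within)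
  have E_all: "E t > 0" if "t \<in> {r..s}" for t
  proof (rule ccontr)
    assume "\<not> E t > 0"
    \<comment> \<open>The least point \<open>z\<close> of \<open>Z\<close> is the first place where
      \<open>E\<close> fails to be positive. Before it \<open>E\<close> is positive, hence
      nondecreasing, so \<open>E z\<close> is at least \<open>E r\<close>, which is
      positive.\<close>
    define Z where "Z = {r..s} \<inter> E -` {..0}"
    have "compact Z" unfolding Z_def
      using continuous_closed_preimage[OF contE] compact_Int_closed[OF compact_Icc[of r s]]
      by (metis Int_left_absorb closed_atLeastAtMost closed_atMost)
    moreover have "Z \<noteq> {}" using that \<open>\<not> E t > 0\<close> by (auto simp: Z_def)
    ultimately obtain z where z: "z \<in> Z" "\<And>y. y \<in> Z \<Longrightarrow> z \<le> y"
      by (metis compact_attains_inf)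
    have zr: "r \<le> z" "z \<le> s" "E z \<le> 0" using z(1) by (auto simp: Z_def)
    have before: "E y > 0" if "r \<le> y" "y < z" for y
      using z(2)[of y] that zr by (force simp: Z_def)
    have "E r \<le> E z"
    proof (rule DERIV_nonneg_imp_increasing_open[OF zr(1)])
      show "continuous_on {r..z} E" using contE zr by (auto elim: continuous_on_subset)
      show "\<exists>y. (E has_real_derivative y) (at x) \<and> 0 \<le> y" if "r < x" "x < z" for x
        using that before[of x] E[of x] E'pos[of x] zr by auto
    qed
    moreover have "E r > 0" using Epos[of r] start r by auto
    ultimately show False using zr by simp
  qed
  \<comment> \<open>Positivity of \<open>E\<close> on the whole interval orders the logarithmic
    slopes, and their order is the sign of the derivative of \<open>U / W\<close>.\<close>
  show ?thesis
  proof (rule DERIV_nonneg_imp_nondecreasing[OF r(2)])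
    fix t assume "r \<le> t" "t \<le> s"
    then have t: "t \<in> {r..s}" by simp
    note pos = U(2)[OF t] W(2)[OF t]
    have "((\<lambda>t. U t / W t) has_real_derivative (- a t * W t - U t * - b t) / (W t * W t)) (at t)"
      using pos by (intro DERIV_divide U W t) auto
    moreover have "a t / U t < b t / W t" using Epos E_all t by blast
    then have "0 \<le> (- a t * W t - U t * - b t) / (W t * W t)"
      using pos by (intro divide_nonneg_nonneg) (auto simp: field_simps)
    ultimately show "\<exists>y. ((\<lambda>t. U t / W t) has_real_derivative y) (at t) \<and> 0 \<le> y" by blast
  qed
qed

text \<open>Finite and infinite outer radii are unified here: all that is extracted from the filter
  is one good radius beyond any prescribed one.\<close>

lemma eventually_to_R0_witness:
  assumes "eventually P (to_R0 R0)" "ereal r < R0"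
  shows "\<exists>s>r. ereal s < R0 \<and> P s"
proof (cases R0)
  case (real c)
  then have "eventually P (at_left c)" "r < c" using assms by (auto simp: to_R0_def)
  then have "eventually (\<lambda>s. P s \<and> s \<in> {r<..<c}) (at_left c)"
    by (intro eventually_conj eventually_at_left_real)
  then have "\<exists>s. P s \<and> s \<in> {r<..<c}"
    by (rule eventually_happens'[rotated]) simp
  then show ?thesis using real by auto
next
  case PInf
  then have "eventually (\<lambda>s. P s \<and> r < s) at_top"
    using assms by (intro eventually_conj eventually_gt_at_top) (simp add: to_R0_def)
  then have "\<exists>s. P s \<and> r < s"
    by (rule eventually_happens'[rotated]) simp
  then show ?thesis using PInf by auto
qed (use assms in auto)

text \<open>The profile slope inequality \<open>(p - 1) c' + n c \<le> v t\<^sup>p\<^sup>-\<^sup>1 c\<^sup>2\<^sup>-\<^sup>p\<close> for \<open>t\<close> with \<open>t' = - c\<close> becomes strict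
  for \<open>\<phi>(t) = t + \<eta> + \<delta> t\<^sup>2\<close>: the convexity of \<open>\<phi>\<close> helps on the left, and \<open>\<delta> t\<^sup>2 \<le> \<eta>\<close> gives
  \<open>\<phi>'(t) t \<le> \<phi>(t)\<close>, so nothing is lost on the right.\<close>

lemma strict_perturbation:
  fixes c c' t v n \<eta> \<delta> p :: real
  assumes p: "p \<ge> 2" and c: "c > 0" and t: "t > 0" and v: "v \<ge> 0"
    and d: "\<delta> > 0" "\<delta> * t\<^sup>2 \<le> \<eta>"
    and le: "(p - 1) * c' + n * c \<le> v * (t powr (p - 1) * c powr (2 - p))"
  shows "(p - 1) * ((1 + 2 * \<delta> * t) * c' - 2 * \<delta> * c\<^sup>2) + n * ((1 + 2 * \<delta> * t) * c)
    < v * ((t + \<eta> + \<delta> * t\<^sup>2) powr (p - 1) * ((1 + 2 * \<delta> * t) * c) powr (2 - p))"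
proof -
  define q where "q = 1 + 2 * \<delta> * t"
  have q: "q > 0" using d t by (simp add: q_def add_pos_pos)
  have "(p - 1) * (q * c' - 2 * \<delta> * c\<^sup>2) + n * (q * c) < q * ((p - 1) * c' + n * c)"
    using p c d by (simp add: algebra_simps)
  also have "\<dots> \<le> q * (v * (t powr (p - 1) * c powr (2 - p)))"
    using q le by (intro mult_left_mono) auto
  also have "q * (v * (t powr (p - 1) * c powr (2 - p)))
      = v * ((q * t) powr (p - 1) * (q * c) powr (2 - p))"
  proof -
    have "q powr (p - 1) * q powr (2 - p) = q"
      using q powr_add[of q "p - 1" "2 - p"] by simp
    moreover have "(q * t) powr (p - 1) * (q * c) powr (2 - p)
        = (q powr (p - 1) * q powr (2 - p)) * (t powr (p - 1) * c powr (2 - p))"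
      using q c t by (simp add: powr_mult)
    ultimately show ?thesis by simp
  qed
  also have "\<dots> \<le> v * ((t + \<eta> + \<delta> * t\<^sup>2) powr (p - 1) * (q * c) powr (2 - p))"
    using q t d p v
    by (intro mult_left_mono mult_right_mono powr_mono2) (auto simp: q_def algebra_simps power2_eq_square)
  finally show ?thesis by (simp add: q_def)
qed

section \<open>Differential inequalities for the profiles\<close>

lemma profile_pos:
  assumes "\<forall>x\<in>annulus_closed r0 R0. w x > 0" "0 < r0" "r0 \<le> r" "ereal r < R0"
  shows "profile w r > (0::real)"
  using assms by (auto simp: profile_def annulus_closed_def)

text \<open>The factor \<open>(- u') powr (p - 2)\<close> in the radial form of the operator is
  positive, so the sign of the operator is the sign of the remaining bracket.\<close>

lemma pos_rad_dec_C2_sub_ode: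
  fixes u :: "'a::euclidean_space \<Rightarrow> real"
  assumes u: "pos_rad_dec_C2_sub p V r0 R0 u" and r0: "0 < r0" and x: "x \<in> annulus_open r0 R0"
  shows "(p - 1) * - deriv (deriv (profile u)) (norm x)
      + (real DIM('a) - 1) / norm x * - deriv (profile u) (norm x)
    \<le> V x * (profile u (norm x) powr (p - 1) * (- deriv (profile u) (norm x)) powr (2 - p))"
proof -
  note * = u[unfolded pos_rad_dec_C2_sub_def C2_subsolution_def]
  have dec: "deriv (profile u) (norm x) < 0"
    using * x by (intro deriv_profile_neg[of r0 R0]) (auto simp: r0 annulus_open_def)
  have pos: "u x > 0" using * x by (auto simp: annulus_open_def annulus_closed_def)
  have "plap_op p V u x \<le> 0" using * x by blast
  then show ?thesis
    using * x pos dec by (subst (asm) plap_op_profile[OF r0]) (auto simp: mult_le_0_iff)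
qed

lemma pos_rad_dec_C2_super_ode:
  fixes v :: "'a::euclidean_space \<Rightarrow> real"
  assumes v: "pos_rad_dec_C2_super p V r0 R0 v" and r0: "0 < r0" and x: "x \<in> annulus_open r0 R0"
  shows "(p - 1) * - deriv (deriv (profile v)) (norm x)
      + (real DIM('a) - 1) / norm x * - deriv (profile v) (norm x)
    \<ge> V x * (profile v (norm x) powr (p - 1) * (- deriv (profile v) (norm x)) powr (2 - p))"
proof -
  note * = v[unfolded pos_rad_dec_C2_super_def C2_supersolution_def]
  have dec: "deriv (profile v) (norm x) < 0"
    using * x by (intro deriv_profile_neg[of r0 R0]) (auto simp: r0 annulus_open_def)
  have pos: "v x > 0" using * x by (auto simp: annulus_open_def annulus_closed_def)
  have "plap_op p V v x \<ge> 0" using * x by blast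
  then show ?thesis
    using * x pos dec by (subst (asm) plap_op_profile[OF r0]) (auto simp: zero_le_mult_iff)
qed

section \<open>Comparison with a supersolution\<close>

lemma C2_onE:
  assumes "C2_on S w"
  obtains U where "open U" "S \<subseteq> U" "\<And>x. x \<in> U \<Longrightarrow> w differentiable (at x)"
    "\<And>x. x \<in> U \<Longrightarrow> grad w differentiable (at x)"
  using assms unfolding C2_on_def C2_open_def by blast

lemma C2_on_imp_continuous_on:
  assumes "C2_on S w"
  shows "continuous_on S w"
proof -
  from assms obtain U where "S \<subseteq> U" "\<And>x. x \<in> U \<Longrightarrow> w differentiable (at x)"
    by (rule C2_onE) blast
  then show ?thesis
    by (auto intro!: continuous_at_imp_continuous_on differentiable_imp_continuous_within)
qed

text \<open>At \<open>x\<close> the function \<open>h\<close> is a strict subsolution: subadditivity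
  of the perspective handles \<open>u - \<epsilon> v\<close>, and the convex perturbation makes the
  inequality strict. By homogeneity \<open>k * w\<close> is a supersolution, so \<open>h\<close>
  cannot touch it from below there.\<close>

lemma perturbed_difference_not_touching:
  fixes u v w V :: "'a::euclidean_space \<Rightarrow> real"
  assumes p: "p \<ge> 2" and r0: "0 < r0" and V: "\<And>x. x \<in> annulus_open r0 R0 \<Longrightarrow> V x \<ge> 0"
    and u: "pos_rad_dec_C2_sub p V r0 R0 u" and v: "pos_rad_dec_C2_super p V r0 R0 v"
    and w: "C2_supersolution p V r0 R0 w" and wpos: "w x > 0"
    and \<epsilon>: "\<epsilon> > 0" and \<delta>: "\<delta> > 0" "\<delta> * (u x - \<epsilon> * v x)\<^sup>2 \<le> \<eta>"
    and x: "x \<in> S" and S: "open S" "S \<subseteq> annulus_open r0 R0"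
    and t: "\<epsilon> * v x < u x"
    and slope: "- deriv (profile v) (norm x) / profile v (norm x)
      \<le> - deriv (profile u) (norm x) / profile u (norm x)"
    and h: "h = (\<lambda>x. (u x - \<epsilon> * v x) + \<eta> + \<delta> * (u x - \<epsilon> * v x)\<^sup>2)"
    and k: "k > 0" "\<And>y. y \<in> S \<Longrightarrow> h y \<le> k * w y" "h x = k * w x"
  shows False
proof -
  have u': "C2_on (annulus_closed r0 R0) u" "radial_on (annulus_closed r0 R0) u"
      "strictly_decreasing_radial r0 R0 u" "\<forall>x\<in>annulus_closed r0 R0. u x > 0"
    using u unfolding pos_rad_dec_C2_sub_def C2_subsolution_def by blast+
  have v': "C2_on (annulus_closed r0 R0) v" "radial_on (annulus_closed r0 R0) v"
      "strictly_decreasing_radial r0 R0 v" "\<forall>x\<in>annulus_closed r0 R0. v x > 0"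
    using v unfolding pos_rad_dec_C2_super_def C2_supersolution_def by blast+
  define U where "U = profile u"
  define W where "W = profile v"
  define a where "a s = - deriv U s" for s
  define b where "b s = - deriv W s" for s
  define r where "r = norm x"
  have xA: "x \<in> annulus_open r0 R0" using x S by blast
  have sub: "annulus_open r0 R0 \<subseteq> (annulus_closed r0 R0 :: 'a set)"
    by (auto simp: annulus_open_def annulus_closed_def)
  have uU: "u y = U (norm y)" and vW: "v y = W (norm y)" if "y \<in> S" for y
    using radial_eq_profile[OF r0 u'(1-3)] radial_eq_profile[OF r0 v'(1-3)] that S(2) sub
    unfolding U_def W_def by blast+
  have inA: "r0 < norm y" "r0 \<le> norm y" "ereal (norm y) < R0" if "y \<in> S" for y :: 'a
    using subsetD[OF S(2) that] by (auto simp: annulus_open_def)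
  have dU: "(U has_real_derivative - a (norm y)) (at (norm y))"
    and dW: "(W has_real_derivative - b (norm y)) (at (norm y))" if "y \<in> S" for y :: 'a
    using profile_has_derivative[OF r0 u'(1-3) inA(2,3)[OF that]]
      profile_has_derivative[OF r0 v'(1-3) inA(2,3)[OF that]]
    unfolding U_def W_def a_def b_def by simp_all
  have da: "(a has_real_derivative - deriv (deriv U) r) (at r)"
    and db: "(b has_real_derivative - deriv (deriv W) r) (at r)"
    using profile_has_second_derivative[OF r0 u'(1-3) inA(1,3)[OF x], THEN DERIV_minus]
      profile_has_second_derivative[OF r0 v'(1-3) inA(1,3)[OF x], THEN DERIV_minus]
    unfolding U_def W_def a_def[abs_def] b_def[abs_def] r_def by this+
  have a_pos: "a r > 0" and b_pos: "b r > 0"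
    using deriv_profile_neg[OF r0 u'(1-3) inA(2,3)[OF x]] deriv_profile_neg[OF r0 v'(1-3) inA(2,3)[OF x]]
    unfolding U_def W_def a_def b_def r_def by simp_all
  have U_pos: "U r > 0" and W_pos: "W r > 0"
    unfolding U_def W_def r_def by (intro profile_pos[of r0 R0] u' v' r0 inA x)+
  \<comment> \<open>Here \<open>c\<close> is minus the derivative of \<open>T\<close> at
    \<open>r\<close> and \<open>c'\<close> the derivative of that slope. Below, \<open>F\<close> is
    the profile of \<open>h\<close>, \<open>g\<close> is its first derivative, and \<open>g'\<close>
    is its second derivative at \<open>r\<close>.\<close>
  define c where "c = a r - \<epsilon> * b r"
  define T where "T s = U s - \<epsilon> * W s" for s
  have ux: "u x = U r" "v x = W r" using uU vW x by (auto simp: r_def)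
  have T_pos: "T r > 0" using t by (simp add: T_def ux)
  \<comment> \<open>The order of the logarithmic slopes combines with
    \<open>\<epsilon> * W r < U r\<close> to give \<open>\<epsilon> * b r < a r\<close>. Thus
    \<open>T\<close> strictly decreases at \<open>r\<close> and the gradient of \<open>h\<close>
    does not vanish.\<close>
  have "\<epsilon> * b r * U r \<le> \<epsilon> * (a r * W r)"
    using slope \<epsilon> U_pos W_pos by (simp add: U_def W_def a_def b_def r_def field_simps)
  also have "\<dots> < a r * U r" using a_pos T_pos by (simp add: T_def mult.left_commute[of \<epsilon>])
  finally have c_pos: "c > 0" using U_pos by (simp add: c_def)
  define g where "g s = (1 + 2 * \<delta> * T s) * - (a s - \<epsilon> * b s)" for s
  define c' where "c' = - deriv (deriv U) r - \<epsilon> * - deriv (deriv W) r"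
  define g' where "g' = - ((1 + 2 * \<delta> * T r) * c' - 2 * \<delta> * c\<^sup>2)"
  have dT: "(T has_real_derivative - (a (norm y) - \<epsilon> * b (norm y))) (at (norm y))" if "y \<in> S" for y :: 'a
    unfolding T_def using dU[OF that] dW[OF that] by (auto intro!: derivative_eq_intros)
  define F where "F s = T s + \<eta> + \<delta> * (T s)\<^sup>2" for s
  have hF: "h y = F (norm y)" if "y \<in> S" for y
    using uU[OF that] vW[OF that] by (simp add: h F_def T_def)
  have dF: "(F has_real_derivative g (norm y)) (at (norm y))" if "y \<in> S" for y :: 'a
    unfolding F_def g_def using dT[OF that]
    by (auto intro!: derivative_eq_intros simp: power2_eq_square algebra_simps)
  have dg: "(g has_real_derivative g') (at (norm x))"
    unfolding g_def g'_def using dT[OF x] da db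
    by (auto intro!: derivative_eq_intros simp: r_def c_def c'_def power2_eq_square algebra_simps)
  have S0: "0 \<notin> S" using S(2) r0 by (auto simp: annulus_open_def)
  have q_pos: "1 + 2 * \<delta> * T r > 0" using \<delta> T_pos by (simp add: add_pos_pos)
  have gr: "g r = - ((1 + 2 * \<delta> * T r) * c)" by (simp add: g_def c_def flip: mult_minus_right)
  then have g_neg: "g r < 0" using q_pos c_pos by simp
  define n where "n = (real DIM('a) - 1) / r"
  \<comment> \<open>Subadditivity is applied to the splittings \<open>U = T + \<epsilon> W\<close>
    and \<open>a = c + \<epsilon> b\<close>. Subtracting \<epsilon> times the supersolution
    inequality, which the 1-homogeneous perspective respects, leaves the subsolution inequality for
    \<open>T\<close>.\<close>
  have le: "(p - 1) * c' + n * c \<le> V x * (T r powr (p - 1) * c powr (2 - p))"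
  proof -
    have 1: "(p - 1) * - deriv (deriv U) r + n * a r \<le> V x * (U r powr (p - 1) * a r powr (2 - p))"
      using pos_rad_dec_C2_sub_ode[OF u r0 xA] by (simp add: U_def a_def r_def n_def)
    have "V x * (W r powr (p - 1) * b r powr (2 - p)) \<le> (p - 1) * - deriv (deriv W) r + n * b r"
      using pos_rad_dec_C2_super_ode[OF v r0 xA] by (simp add: W_def b_def r_def n_def)
    from mult_left_mono[OF this, of \<epsilon>] have 2: "V x * (\<epsilon> * (W r powr (p - 1) * b r powr (2 - p)))
        \<le> \<epsilon> * ((p - 1) * - deriv (deriv W) r + n * b r)"
      using \<epsilon> by (simp add: mult.left_commute)
    have "\<epsilon> powr (p - 1) * \<epsilon> powr (2 - p) = \<epsilon>"
      using \<epsilon> powr_add[of \<epsilon> "p - 1" "2 - p"] by simp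
    then have 3: "(\<epsilon> * W r) powr (p - 1) * (\<epsilon> * b r) powr (2 - p)
        = \<epsilon> * (W r powr (p - 1) * b r powr (2 - p))"
      using \<epsilon> W_pos b_pos by (simp add: powr_mult mult_ac)
    have "(T r + \<epsilon> * W r) powr (p - 1) * (c + \<epsilon> * b r) powr (2 - p)
      \<le> T r powr (p - 1) * c powr (2 - p) + (\<epsilon> * W r) powr (p - 1) * (\<epsilon> * b r) powr (2 - p)"
      using p T_pos c_pos \<epsilon> W_pos b_pos by (intro perspective_powr_subadditive) auto
    then have "U r powr (p - 1) * a r powr (2 - p)
      \<le> T r powr (p - 1) * c powr (2 - p) + \<epsilon> * (W r powr (p - 1) * b r powr (2 - p))"
      unfolding 3 by (simp add: T_def c_def)
    from mult_left_mono[OF this V[OF xA]]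
    have "V x * (U r powr (p - 1) * a r powr (2 - p)) \<le> V x * (T r powr (p - 1) * c powr (2 - p))
       + V x * (\<epsilon> * (W r powr (p - 1) * b r powr (2 - p)))"
      by (simp add: distrib_left)
    with 1 2 show ?thesis by (simp add: c_def c'_def algebra_simps)
  qed
  have strict: "(p - 1) * - g' + n * - g r < V x * (F r powr (p - 1) * (- g r) powr (2 - p))"
    using strict_perturbation[OF p c_pos T_pos V[OF xA] \<delta>(1) _ le, of \<eta>] \<delta>(2)
    by (simp add: gr g'_def F_def T_def ux)
  obtain Y where Y: "annulus_closed r0 R0 \<subseteq> Y" "\<And>y. y \<in> Y \<Longrightarrow> w differentiable (at y)"
    "\<And>y. y \<in> Y \<Longrightarrow> grad w differentiable (at y)"
    using w unfolding C2_supersolution_def by (elim conjE C2_onE) blast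
  have SY: "S \<subseteq> Y" using S(2) sub Y(1) by blast
  have "p_laplacian p h x \<le> k powr (p - 1) * p_laplacian p w x"
  proof (rule p_laplacian_touching[where S = S and h = h and w = w, OF p k(1) S(1) x k(2,3)])
    show "h differentiable (at y)" if "y \<in> S" for y
      by (rule differentiableI[OF radial_has_derivative[of S h F g, OF S(1) S0 hF dF that]])
    show "grad h differentiable (at x)"
      by (rule differentiableI[OF grad_radial_has_derivative[of S h F g, OF S(1) S0 hF dF x dg]])
    show "grad h x \<noteq> 0"
      using grad_radial[of S h F g, OF S(1) S0 hF dF x] g_neg x S0 by (auto simp: r_def)
    show "w differentiable (at y)" if "y \<in> S" for y using Y(2) SY that by blast
    show "grad w differentiable (at x)" using Y(3) SY x by blast
  qed
  also have "\<dots> \<le> k powr (p - 1) * (- (V x * w x powr (p - 1)))"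
  proof -
    have "w x powr (p - 1) = \<bar>w x\<bar> powr (p - 2) * w x"
      using wpos powr_add[of "w x" "p - 2" 1] by simp
    moreover have "plap_op p V w x \<ge> 0" using w xA by (auto simp: C2_supersolution_def)
    ultimately have "p_laplacian p w x \<le> - (V x * w x powr (p - 1))"
      by (simp add: plap_op_def mult.assoc)
    then show ?thesis by (intro mult_left_mono) auto
  qed
  also have "\<dots> = - (V x * F r powr (p - 1))"
    using k(1,3) wpos by (simp add: hF[OF x] r_def powr_mult mult_ac)
  finally have "p_laplacian p h x \<le> - (V x * F r powr (p - 1))" .
  moreover have "p_laplacian p h x = - ((- g r) powr (p - 2) * ((p - 1) * - g' + n * - g r))"
  proof -
    have "p_laplacian p h x = \<bar>g r\<bar> powr (p - 2) * ((p - 1) * g' + n * g r)"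
      unfolding r_def n_def
      by (rule p_laplacian_radial[of S h F g, OF S(1) S0 hF dF x dg]) (use g_neg in \<open>simp_all add: r_def\<close>)
    then show ?thesis unfolding abs_of_neg[OF g_neg] by (simp add: algebra_simps)
  qed
  \<comment> \<open>Restoring the positive factor turns the strict profile inequality into a strict
    lower bound on the p-Laplacian of \<open>h\<close>, against the upper bound obtained by
    touching.\<close>
  moreover have "(- g r) powr (p - 2) * ((p - 1) * - g' + n * - g r)
    < (- g r) powr (p - 2) * (V x * (F r powr (p - 1) * (- g r) powr (2 - p)))"
    using strict g_neg by (intro mult_strict_left_mono) simp_all
  moreover have "(- g r) powr (p - 2) * (V x * (F r powr (p - 1) * (- g r) powr (2 - p)))
    = V x * F r powr (p - 1)"
    using g_neg powr_add[of "- g r" "p - 2" "2 - p"] by (simp add: mult_ac)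
  ultimately show False by linarith
qed

text \<open>The quotient of the perturbed difference by \<open>w\<close> attains its maximum on the
  compact shell. On the inner sphere \<open>C\<close> controls it, on the outer sphere the
  difference is nonpositive, and an interior maximum with positive difference is impossible.\<close>

lemma shell_bound:
  fixes u v w V :: "'a::euclidean_space \<Rightarrow> real"
  assumes p: "p \<ge> 2" and r0: "0 < r0" and V: "\<And>x. x \<in> annulus_open r0 R0 \<Longrightarrow> V x \<ge> 0"
    and u: "pos_rad_dec_C2_sub p V r0 R0 u" and v: "pos_rad_dec_C2_super p V r0 R0 v"
    and w: "C2_supersolution p V r0 R0 w" and wpos: "\<forall>x\<in>annulus_closed r0 R0. w x > 0"
    and slope: "\<And>r. r0 < r \<Longrightarrow> ereal r < R0 \<Longrightarrow>
      - deriv (profile v) r / profile v r \<le> - deriv (profile u) r / profile u r"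
    and \<epsilon>: "\<epsilon> > 0" and \<rho>: "r0 < \<rho>" "ereal \<rho> < R0" "profile u \<rho> \<le> \<epsilon> * profile v \<rho>"
    and C: "C > 0" "\<And>x. norm x = r0 \<Longrightarrow> u x \<le> C * w x"
    and z: "r0 \<le> norm z" "norm z \<le> \<rho>"
  shows "u z - \<epsilon> * v z \<le> C * w z"
proof -
  have u': "C2_on (annulus_closed r0 R0) u" "radial_on (annulus_closed r0 R0) u"
      "strictly_decreasing_radial r0 R0 u"
    using u unfolding pos_rad_dec_C2_sub_def C2_subsolution_def by blast+
  have v': "C2_on (annulus_closed r0 R0) v" "radial_on (annulus_closed r0 R0) v"
      "strictly_decreasing_radial r0 R0 v" "\<forall>x\<in>annulus_closed r0 R0. v x > 0"
    using v unfolding pos_rad_dec_C2_super_def C2_supersolution_def by blast+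
  define K where "K = {x::'a. r0 \<le> norm x \<and> norm x \<le> \<rho>}"
  have "K = cball 0 \<rho> - ball 0 r0" by (auto simp: K_def)
  then have K: "compact K" by (simp add: compact_diff)
  have zK: "z \<in> K" using z by (simp add: K_def)
  have below: "ereal s < R0" if "s \<le> \<rho>" for s
    by (rule le_less_trans[OF _ \<rho>(2)]) (simp add: that)
  have KA: "K \<subseteq> annulus_closed r0 R0"
    by (auto simp: K_def annulus_closed_def below)
  define t where "t x = u x - \<epsilon> * v x" for x
  have "C2_on (annulus_closed r0 R0) w" using w by (simp add: C2_supersolution_def)
  note contA = this[THEN C2_on_imp_continuous_on] u'(1)[THEN C2_on_imp_continuous_on]
    v'(1)[THEN C2_on_imp_continuous_on]
  note cont' = contA[THEN continuous_on_subset, OF KA]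
  have cont: "continuous_on K w" "continuous_on K t"
    unfolding t_def[abs_def] by (intro continuous_intros cont')+
  have wK: "w x > 0" if "x \<in> K" for x using wpos KA that by blast
  obtain y where y: "y \<in> K" "\<And>x. x \<in> K \<Longrightarrow> w y \<le> w x"
    using continuous_attains_inf[OF K _ cont(1)] zK by blast
  define m where "m = w y"
  have m: "m > 0" "\<And>x. x \<in> K \<Longrightarrow> m \<le> w x" using y wK by (auto simp: m_def)
  have "bounded (t ` K)" using compact_continuous_image[OF cont(2) K] compact_imp_bounded by blast
  then obtain M where M: "M > 0" "\<And>x. x \<in> K \<Longrightarrow> \<bar>t x\<bar> \<le> M"
    unfolding bounded_pos by auto
  \<comment> \<open>The perturbation adds at most \<open>2 * \<eta>\<close>, which the positive
    minimum \<open>m\<close> of \<open>w\<close> on the shell converts into the multiple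
    \<open>2 * \<eta> / m\<close> of \<open>w\<close>.\<close>
  have key: "t z \<le> (C + 2 * \<eta> / m) * w z" if \<eta>: "\<eta> > 0" for \<eta>
  proof -
    \<comment> \<open>With \<open>M\<close> bounding the difference on the shell, this choice makes
      the quadratic term at most \<eta>, as the strict perturbation requires.\<close>
    define \<delta> where "\<delta> = \<eta> / M\<^sup>2"
    have \<delta>: "\<delta> > 0" using \<eta> M by (simp add: \<delta>_def)
    have \<delta>t: "\<delta> * (t x)\<^sup>2 \<le> \<eta>" if "x \<in> K" for x
    proof -
      have "(t x)\<^sup>2 \<le> M\<^sup>2" using M(2)[OF that] M(1) by (intro abs_le_square_iff[THEN iffD1]) auto
      then have "\<delta> * (t x)\<^sup>2 \<le> \<delta> * M\<^sup>2" using \<delta> by (intro mult_left_mono) auto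
      then show ?thesis using M(1) by (simp add: \<delta>_def)
    qed
    define h where "h = (\<lambda>x. t x + \<eta> + \<delta> * (t x)\<^sup>2)"
    have "continuous_on K (\<lambda>x. h x / w x)"
      unfolding h_def using wK by (intro continuous_intros cont) (auto dest: less_imp_neq[OF wK, THEN not_sym])
    then obtain x where x: "x \<in> K" "\<And>y. y \<in> K \<Longrightarrow> h y / w y \<le> h x / w x"
      using continuous_attains_sup[OF K] zK by blast
    define k where "k = h x / w x"
    have hk: "h y \<le> k * w y" if "y \<in> K" for y
      using x(2)[OF that] wK[OF that] by (simp add: k_def pos_divide_le_eq)
    have hx: "h x \<le> t x + 2 * \<eta>" using \<delta>t[OF x(1)] by (simp add: h_def)
    have \<eta>m: "2 * \<eta> \<le> 2 * \<eta> / m * w x"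
      using m(1) m(2)[OF x(1)] \<eta> by (simp add: field_simps)
    have "h x \<le> (C + 2 * \<eta> / m) * w x"
    proof (cases "t x \<le> 0 \<or> norm x = r0")
      case True
      then have "t x \<le> C * w x"
      proof
        assume "t x \<le> 0"
        then show ?thesis using mult_pos_pos[OF C(1) wK[OF x(1)]] by linarith
      next
        assume "norm x = r0"
        moreover have "v x > 0" using v'(4) x(1) KA by blast
        ultimately show ?thesis using C(2)[of x] \<epsilon> mult_pos_pos[of \<epsilon> "v x"]
          unfolding t_def by linarith
      qed
      then show ?thesis using hx \<eta>m by (simp add: distrib_right)
    next
      case False
      have "norm x \<noteq> \<rho>"
      proof
        assume eq: "norm x = \<rho>"
        have "u x = profile u \<rho>" "v x = profile v \<rho>"
          using radial_eq_profile[OF r0 u'] radial_eq_profile[OF r0 v'(1-3)] x(1) KA eq by blast+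
        then show False using False \<rho>(3) by (simp add: t_def)
      qed
      \<comment> \<open>The maximum point now lies in the open shell with positive difference, and
        maximality of the quotient says that \<open>h\<close> touches \<open>k * w\<close> from
        below there.\<close>
      define S where "S = {y::'a. r0 < norm y \<and> norm y < \<rho>}"
      have S: "open S" unfolding S_def
        by (intro open_Collect_conj open_Collect_less continuous_on_const continuous_on_norm_id)
      have xS: "x \<in> S" using x(1) False \<open>norm x \<noteq> \<rho>\<close> by (simp add: S_def K_def)
      have SK: "S \<subseteq> K" by (auto simp: S_def K_def)
      have SA: "S \<subseteq> annulus_open r0 R0"
        by (auto simp: S_def annulus_open_def below)
      have "h x > 0" using False \<eta> \<delta> by (simp add: h_def add_pos_nonneg)
      then have "k > 0" using wK[OF x(1)] by (simp add: k_def)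
      moreover have "h x = k * w x" using wK[OF x(1)] by (simp add: k_def)
      moreover have "h y \<le> k * w y" if "y \<in> S" for y using hk that SK by blast
      moreover have "- deriv (profile v) (norm x) / profile v (norm x)
          \<le> - deriv (profile u) (norm x) / profile u (norm x)"
        using xS SA by (intro slope) (auto simp: annulus_open_def)
      ultimately show ?thesis
        using perturbed_difference_not_touching[OF p r0 V u v w wK[OF x(1)] \<epsilon> \<delta> _ xS S SA, of \<eta> h k]
          \<delta>t[OF x(1)] False by (simp add: t_def h_def)
    qed
    then have "k \<le> C + 2 * \<eta> / m" using wK[OF x(1)] by (simp add: k_def pos_divide_le_eq)
    then have "k * w z \<le> (C + 2 * \<eta> / m) * w z" using wK[OF zK] by (intro mult_right_mono) auto
    moreover have "t z \<le> h z" using \<eta> \<delta> by (simp add: h_def)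
    ultimately show ?thesis using hk[OF zK] by linarith
  qed
  have "t z \<le> C * w z"
  proof (rule field_le_epsilon)
    fix e :: real assume e: "e > 0"
    \<comment> \<open>The value of \<eta> is chosen so that the error at \<open>z\<close> is exactly
      \<open>e\<close>.\<close>
    have "(C + 2 * (e * m / (2 * w z)) / m) * w z = C * w z + e"
      using m(1) wK[OF zK] by (simp add: field_simps)
    then show "t z \<le> C * w z + e" using key[of "e * m / (2 * w z)"] e m(1) wK[OF zK] by simp
  qed
  then show ?thesis by (simp add: t_def)
qed

text \<open>If the slope of \<open>v\<close> were strictly larger at one radius, the Riccati
  comparison would keep \<open>u / v\<close> from falling below its value there at any larger
  radius. But the quotient becomes arbitrarily small near the outer boundary.\<close>

lemma log_slope_order:
  fixes u v V :: "'a::euclidean_space \<Rightarrow> real"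
  assumes p: "p \<ge> 2" and r0: "0 < r0"
    and u: "pos_rad_dec_C2_sub p V r0 R0 u" and v: "pos_rad_dec_C2_super p V r0 R0 v"
    and lim: "\<And>e r. e > 0 \<Longrightarrow> ereal r < R0 \<Longrightarrow> \<exists>s>r. ereal s < R0 \<and> profile u s / profile v s < e"
    and r: "r0 < r" "ereal r < R0"
  shows "- deriv (profile v) r / profile v r \<le> - deriv (profile u) r / profile u r"
proof (rule ccontr)
  assume "\<not> ?thesis"
  then have less: "- deriv (profile u) r / profile u r < - deriv (profile v) r / profile v r" by simp
  have u': "C2_on (annulus_closed r0 R0) u" "radial_on (annulus_closed r0 R0) u"
      "strictly_decreasing_radial r0 R0 u" "\<forall>x\<in>annulus_closed r0 R0. u x > 0"
    using u unfolding pos_rad_dec_C2_sub_def C2_subsolution_def by blast+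
  have v': "C2_on (annulus_closed r0 R0) v" "radial_on (annulus_closed r0 R0) v"
      "strictly_decreasing_radial r0 R0 v" "\<forall>x\<in>annulus_closed r0 R0. v x > 0"
    using v unfolding pos_rad_dec_C2_super_def C2_supersolution_def by blast+
  have pos: "profile u s > 0" "profile v s > 0" if "r0 < s" "ereal s < R0" for s
    using profile_pos[OF u'(4) r0] profile_pos[OF v'(4) r0] that by auto
  define q where "q = profile u r / profile v r"
  have "q > 0" using pos[OF r] by (simp add: q_def)
  from lim[OF this r(2)] obtain s where s: "s > r" "ereal s < R0" "profile u s / profile v s < q"
    by blast
  have inA: "r0 < t" "r0 \<le> t" "ereal t < R0" if "t \<in> {r..s}" for t
  proof -
    show "r0 < t" "r0 \<le> t" using that r by auto
    show "ereal t < R0" by (rule le_less_trans[OF _ s(2)]) (use that in simp)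
  qed
  have xA: "t *\<^sub>R (unit_dir :: 'a) \<in> annulus_open r0 R0" and norm: "norm (t *\<^sub>R (unit_dir :: 'a)) = t"
    if "t \<in> {r..s}" for t
    using inA[OF that] r0 by (auto simp: annulus_open_def)
  have "profile u r / profile v r \<le> profile u s / profile v s"
  proof (rule ratio_nondecreasing_after[of p r s "profile u" "\<lambda>t. - deriv (profile u) t"
        "\<lambda>t. - deriv (deriv (profile u)) t" "profile v" "\<lambda>t. - deriv (profile v) t"
        "\<lambda>t. - deriv (deriv (profile v)) t" "real DIM('a) - 1" "\<lambda>t. V (t *\<^sub>R unit_dir)"])
    fix t assume t: "t \<in> {r..s}"
    show "(profile u has_real_derivative - (- deriv (profile u) t)) (at t)"
      using profile_has_derivative[OF r0 u'(1-3) inA(2,3)[OF t]] by simp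
    show "(profile v has_real_derivative - (- deriv (profile v) t)) (at t)"
      using profile_has_derivative[OF r0 v'(1-3) inA(2,3)[OF t]] by simp
    show "((\<lambda>t. - deriv (profile u) t) has_real_derivative - deriv (deriv (profile u)) t) (at t)"
      by (rule DERIV_minus[OF profile_has_second_derivative[OF r0 u'(1-3) inA(1,3)[OF t]]])
    show "((\<lambda>t. - deriv (profile v) t) has_real_derivative - deriv (deriv (profile v)) t) (at t)"
      by (rule DERIV_minus[OF profile_has_second_derivative[OF r0 v'(1-3) inA(1,3)[OF t]]])
    show "profile u t > 0" "profile v t > 0" using pos inA[OF t] by auto
    show "- deriv (profile u) t > 0" using deriv_profile_neg[OF r0 u'(1-3) inA(2,3)[OF t]] by simp
    show "- deriv (profile v) t > 0" using deriv_profile_neg[OF r0 v'(1-3) inA(2,3)[OF t]] by simp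
    show "(p - 1) * - deriv (deriv (profile u)) t + (real DIM('a) - 1) / t * - deriv (profile u) t
      \<le> V (t *\<^sub>R unit_dir) * (profile u t powr (p - 1) * (- deriv (profile u) t) powr (2 - p))"
      using pos_rad_dec_C2_sub_ode[OF u r0 xA[OF t]] unfolding norm[OF t] .
    show "(p - 1) * - deriv (deriv (profile v)) t + (real DIM('a) - 1) / t * - deriv (profile v) t
      \<ge> V (t *\<^sub>R unit_dir) * (profile v t powr (p - 1) * (- deriv (profile v) t) powr (2 - p))"
      using pos_rad_dec_C2_super_ode[OF v r0 xA[OF t]] unfolding norm[OF t] .
  qed (use p r r0 s less in auto)
  then show False using s(3) by (simp add: q_def)
qed

section \<open>The dichotomy\<close>

theorem theorem3p5:
  fixes p r0 :: real and R0 :: ereal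
    and V u :: "'a::euclidean_space \<Rightarrow> real"
  assumes "DIM('a) \<ge> 2"
    and "p \<ge> 2"
    and "0 < r0" and "ereal r0 < R0"
    and "continuous_on (annulus_open r0 R0) V"
    and "(\<forall>x\<in>annulus_open r0 R0. V x > 0) \<or> (\<forall>x\<in>annulus_open r0 R0. V x = 0)"
    and "condition_star p V r0 R0"
    and "\<exists>v. pos_rad_dec_C2_super p V r0 R0 v"
    and "pos_rad_dec_C2_sub p V r0 R0 u"
  shows "(\<forall>w. C2_supersolution p V r0 R0 w \<and> (\<forall>x\<in>annulus_closed r0 R0. w x > 0) \<longrightarrow>
            (\<exists>C>0. \<forall>x\<in>annulus_closed r0 R0. u x \<le> C * w x))
       \<or> (\<forall>v. pos_rad_dec_C2_super p V r0 R0 v \<longrightarrow>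
            Limsup (to_R0 R0) (\<lambda>r. ereal (profile u r / profile v r)) > 0)"
proof (rule disjCI, intro allI impI)
  note p = assms(2) and r0 = assms(3) and u = assms(9)
  have V: "V x \<ge> 0" if "x \<in> annulus_open r0 R0" for x
    using assms(6) that by force
  assume "\<not> (\<forall>v. pos_rad_dec_C2_super p V r0 R0 v \<longrightarrow>
            Limsup (to_R0 R0) (\<lambda>r. ereal (profile u r / profile v r)) > 0)"
  then obtain v where v: "pos_rad_dec_C2_super p V r0 R0 v"
    and L: "Limsup (to_R0 R0) (\<lambda>r. ereal (profile u r / profile v r)) \<le> 0"
    unfolding not_less[symmetric] by blast
  fix w assume "C2_supersolution p V r0 R0 w \<and> (\<forall>x\<in>annulus_closed r0 R0. w x > 0)"
  then have w: "C2_supersolution p V r0 R0 w" and wpos: "\<forall>x\<in>annulus_closed r0 R0. w x > 0" by auto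
  have u': "C2_on (annulus_closed r0 R0) u" "\<forall>x\<in>annulus_closed r0 R0. u x > 0"
    using u unfolding pos_rad_dec_C2_sub_def C2_subsolution_def by blast+
  have v': "\<forall>x\<in>annulus_closed r0 R0. v x > 0"
    using v unfolding pos_rad_dec_C2_super_def by blast
  have lim: "\<exists>s>r. ereal s < R0 \<and> profile u s / profile v s < e" if "e > 0" "ereal r < R0" for e r
  proof -
    have "Limsup (to_R0 R0) (\<lambda>r. ereal (profile u r / profile v r)) < ereal e"
      using le_less_trans[OF L] that by simp
    then have "eventually (\<lambda>s. ereal (profile u s / profile v s) < ereal e) (to_R0 R0)"
      by (rule Limsup_lessD)
    from eventually_to_R0_witness[OF this that(2)] show ?thesis by simp
  qed
  have slope: "- deriv (profile v) r / profile v r \<le> - deriv (profile u) r / profile u r"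
    if "r0 < r" "ereal r < R0" for r
    using log_slope_order[OF p r0 u v lim that] .
  have sphere: "sphere 0 r0 \<subseteq> (annulus_closed r0 R0 :: 'a set)"
    using assms(4) by (auto simp: annulus_closed_def)
  have "continuous_on (sphere 0 r0) (\<lambda>x. u x / w x)"
  proof (intro continuous_on_divide)
    show "continuous_on (sphere 0 r0) u"
      by (rule continuous_on_subset[OF C2_on_imp_continuous_on[OF u'(1)] sphere])
    have "C2_on (annulus_closed r0 R0) w" using w by (simp add: C2_supersolution_def)
    then show "continuous_on (sphere 0 r0) w"
      by (rule continuous_on_subset[OF C2_on_imp_continuous_on sphere])
    show "\<forall>x\<in>sphere 0 r0. w x \<noteq> 0"
      using wpos sphere by (metis less_irrefl subsetD)
  qed
  moreover have "sphere (0::'a) r0 \<noteq> {}" using r0 by simp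
  ultimately obtain y where y: "y \<in> sphere 0 r0" "\<And>x. x \<in> sphere 0 r0 \<Longrightarrow> u x / w x \<le> u y / w y"
    using continuous_attains_sup[OF compact_sphere] by blast
  \<comment> \<open>The constant is fixed on the inner sphere before \<epsilon> and the outer radius
    of the shell are chosen, so it survives the limit.\<close>
  define C where "C = u y / w y"
  have C: "C > 0" using y(1) sphere u'(2) wpos by (auto simp: C_def intro!: divide_pos_pos)
  have C_le: "u x \<le> C * w x" if "norm x = r0" for x
  proof -
    have x: "x \<in> sphere 0 r0" using that by simp
    then have "w x > 0" using wpos sphere by blast
    then show ?thesis using y(2)[OF x] by (simp add: C_def pos_divide_le_eq)
  qed
  have "u x \<le> C * w x" if x: "x \<in> annulus_closed r0 R0" for x
  proof (rule field_le_epsilon)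
    fix e :: real assume e: "e > 0"
    have vx: "v x > 0" using v' x by blast
    have nx: "r0 \<le> norm x" "ereal (norm x) < R0" using x by (auto simp: annulus_closed_def)
    \<comment> \<open>This makes the subtracted term \<epsilon> \<open>* v x\<close> equal to the
      tolerance \<open>e\<close>. The shell then ends at a radius beyond \<open>norm x\<close> where
      \<open>u\<close> has dropped below \<epsilon> times \<open>v\<close>.\<close>
    define \<epsilon> where "\<epsilon> = e / v x"
    have \<epsilon>: "\<epsilon> > 0" using e vx by (simp add: \<epsilon>_def)
    from lim[OF \<epsilon> nx(2)] obtain \<rho> where \<rho>: "\<rho> > norm x" "ereal \<rho> < R0" "profile u \<rho> / profile v \<rho> < \<epsilon>"
      by blast
    then have "profile v \<rho> > 0" using profile_pos[OF v' r0] nx by simp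
    with \<rho>(3) have "profile u \<rho> \<le> \<epsilon> * profile v \<rho>" by (simp add: pos_divide_less_eq)
    from shell_bound[OF p r0 V u v w wpos slope \<epsilon> _ \<rho>(2) this C C_le nx(1)] \<rho>(1) nx(1)
    have "u x - \<epsilon> * v x \<le> C * w x" by simp
    then show "u x \<le> C * w x + e" using vx by (simp add: \<epsilon>_def)
  qed
  with C show "\<exists>C>0. \<forall>x\<in>annulus_closed r0 R0. u x \<le> C * w x" by blast
qed

end
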